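(* Let $\alpha\in(0,1]$, $a\in\mathbb{R}$ and let $F:[a,\infty)\times\mathbb{R}^n\to\mathbb{R}^n$ be in $(C,Lip)$ on $[a,\infty)\times\mathbb{R}^n$. Assume that $F(t,0)=0$ for every $t\ge a$, and that $|F(t,x)|\le k(t)|x|$ for every $t\ge a$, $x\in\mathbb{R}^n$ and some continuous function $k$ such that $$\int_a^{\infty}\frac{k(t)}{T(t,\alpha)}\,dt<\infty .$$ Then the trivial solution $x\equiv0$ of the initial value problem $$G_T^{\alpha}x(t)=F(t,x),\qquad x(t_0)=x_0 \qquad (t_0\ge a,\ x_0\in\mathbb{R}^n)$$ is uniformly stable.
   Context: $T(t,\alpha)$ is a given kernel: for the fixed $\alpha$, $t\mapsto T(t,\alpha)$ is a positive continuous function on $[a,\infty)$. For $\alpha\in(0,1]$, the generalized derivative of order $\alpha$ at $t$ is $$G_T^{\alpha}f(t)=\lim_{h\to0}\frac{f(t)-f\big(t-hT(t,\alpha)\big)}{h}$$ (with $h\to0^-$ at the left endpoint $t=a$ of the domain), applied componentwise to vector-valued functions. $F$ is in $(C,Lip)$ on a set $D$ of pairs $(t,x)$ if $F$ is continuous on $D$ and Lipschitz in the second variable on $D$, i.e. there is $L$ with $|F(t,x_1)-F(t,x_2)|\le L|x_1-x_2|$ whenever $(t,x_1),(t,x_2)\in D$. Under this hypothesis the initial value problem has a unique solution on $[a,\infty)$. When $F(t,0)=0$ for every $t\ge a$, the trivial solution $x\equiv0$ is uniformly stable if for any $\varepsilon>0$ there exists $\delta=\delta(\varepsilon)>0$ (independent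 of $t_0$) such that, for every $t_0\ge a$, if $|x_0|<\delta$ then the solution $x(t)$ with $x(t_0)=x_0$ satisfies $|x(t)|<\varepsilon$ for every $t\ge t_0$. *)

theory Defs
  imports "HOL-Analysis.Analysis"
begin

(* f has generalized derivative l of order alpha at t, as a function on [a, oo).
   At t = a the one-sided limit h -> 0- is the one for which t - h * T t alpha stays in [a, oo),
   so values of f to the left of a never matter. *)
definition has_gen_deriv ::
    "(real \<Rightarrow> real \<Rightarrow> real) \<Rightarrow> real \<Rightarrow> real \<Rightarrow> (real \<Rightarrow> real) \<Rightarrow> real \<Rightarrow> real \<Rightarrow> bool"
  where "has_gen_deriv T \<alpha> a f l t \<longleftrightarrow>
    ((\<lambda>h. (f t - f (t - h * T t \<alpha>)) / h) \<longlongrightarrow> l) (if t = a then at_left 0 else at 0)"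

definition has_gen_deriv_vec ::
    "(real \<Rightarrow> real \<Rightarrow> real) \<Rightarrow> real \<Rightarrow> real \<Rightarrow> (real \<Rightarrow> real ^ 'n) \<Rightarrow> real ^ 'n \<Rightarrow> real \<Rightarrow> bool"
  where "has_gen_deriv_vec T \<alpha> a x v t \<longleftrightarrow>
    (\<forall>i. has_gen_deriv T \<alpha> a (\<lambda>s. x s $ i) (v $ i) t)"

definition C_Lip_on :: "(real \<times> (real ^ 'n)) set \<Rightarrow> (real \<Rightarrow> real ^ 'n \<Rightarrow> real ^ 'n) \<Rightarrow> bool"
  where "C_Lip_on D F \<longleftrightarrow>
    continuous_on D (\<lambda>(t, x). F t x) \<and>
    (\<exists>L. \<forall>t x1 x2. (t, x1) \<in> D \<longrightarrow> (t, x2) \<in> D \<longrightarrow>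
        norm (F t x1 - F t x2) \<le> L * norm (x1 - x2))"

(* Solutions live on all of [a, oo), also to the left of the initial time t0. *)
definition ivp_solution ::
    "(real \<Rightarrow> real \<Rightarrow> real) \<Rightarrow> real \<Rightarrow> real \<Rightarrow> (real \<Rightarrow> real ^ 'n \<Rightarrow> real ^ 'n) \<Rightarrow>
     real \<Rightarrow> real ^ 'n \<Rightarrow> (real \<Rightarrow> real ^ 'n) \<Rightarrow> bool"
  where "ivp_solution T \<alpha> a F t0 x0 x \<longleftrightarrow>
    (\<forall>t\<ge>a. has_gen_deriv_vec T \<alpha> a x (F t (x t)) t) \<and> x t0 = x0"

(* Meaningful when F t 0 = 0 for all t >= a; "the solution" is rendered by quantifying over all
   functions solving the problem, which agree on [a, oo) when F is continuous and Lipschitz. *)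
definition uniformly_stable_zero ::
    "(real \<Rightarrow> real \<Rightarrow> real) \<Rightarrow> real \<Rightarrow> real \<Rightarrow> (real \<Rightarrow> real ^ 'n \<Rightarrow> real ^ 'n) \<Rightarrow> bool"
  where "uniformly_stable_zero T \<alpha> a F \<longleftrightarrow>
    (\<forall>\<epsilon>>0. \<exists>\<delta>>0. \<forall>t0\<ge>a. \<forall>x0 x. norm x0 < \<delta> \<longrightarrow> ivp_solution T \<alpha> a F t0 x0 x \<longrightarrow>
        (\<forall>t\<ge>t0. norm (x t) < \<epsilon>))"

end

theory Submission imports Defs begin

text \<open>
  A solution satisfies \<open>x' = F t x / T t \<alpha>\<close> in the ordinary sense, so with
  \<open>K t = \<integral>\<^sub>a\<^sup>t k s / T s \<alpha> ds\<close> the function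
  \<open>\<bar>x t\<bar>\<^sup>2 exp (- 2 K t)\<close> is nonincreasing by Cauchy-Schwarz. Hence
  \<open>\<bar>x t\<bar> \<le> exp I \<bar>x t\<^sub>0\<bar>\<close> for \<open>t \<ge> t\<^sub>0\<close>, where \<open>I\<close> is the integral over the
  whole half-line, and \<open>\<delta> = \<epsilon> / exp I\<close> does not depend on \<open>t\<^sub>0\<close>.
\<close>

text \<open>Substituting \<open>h = (t - y) / T t \<alpha>\<close> turns the defining quotient into
  \<open>T t \<alpha>\<close> times the ordinary difference quotient.\<close>

lemma has_gen_deriv_imp_has_real_derivative:
  assumes deriv: "has_gen_deriv T \<alpha> a f l t" and "t \<ge> a" and pos: "T t \<alpha> > 0"
  shows "(f has_real_derivative l / T t \<alpha>) (at t within {a..})"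
proof -
  let ?c = "T t \<alpha>"
  let ?h = "\<lambda>y. (t - y) / ?c"
  have h0: "(?h \<longlongrightarrow> 0) (at t within {a..})"
    using pos by (auto intro!: tendsto_eq_intros)
  \<comment> \<open>Points \<open>y > a\<close> give \<open>h < 0\<close> when \<open>t = a\<close>,
    so the left-hand limit in \<open>h\<close> matches the right-hand limit in
    \<open>y\<close>.\<close>
  have "filterlim ?h (if t = a then at_left 0 else at 0) (at t within {a..})"
  proof (cases "t = a")
    case True
    have "eventually (\<lambda>y. ?h y \<in> {..<0} \<and> ?h y \<noteq> 0) (at t within {a..})"
      unfolding eventually_at_filter using pos True by (auto simp: divide_less_0_iff)
    then show ?thesis using True h0 by (auto simp: filterlim_at)
  next
    case False
    have "eventually (\<lambda>y. ?h y \<noteq> 0) (at t within {a..})"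
      unfolding eventually_at_filter using pos by auto
    then show ?thesis using False h0 by (auto simp: filterlim_at)
  qed
  from filterlim_compose[OF deriv[unfolded has_gen_deriv_def] this]
  have "((\<lambda>y. (f t - f (t - ?h y * ?c)) / ?h y / ?c) \<longlongrightarrow> l / ?c) (at t within {a..})"
    using pos by (intro tendsto_divide[OF _ tendsto_const]) simp_all
  \<comment> \<open>At \<open>y = t\<close> both sides are 0 by the convention for division by 0, so
    the equation holds for every \<open>y\<close>.\<close>
  moreover have "(f t - f (t - ?h y * ?c)) / ?h y / ?c = (f y - f t) / (y - t)" for y
    using pos by (cases "y = t") (auto simp: divide_simps algebra_simps)
  ultimately show ?thesis
    by (simp add: has_field_derivative_iff)
qed

lemma has_gen_deriv_vec_imp_has_vector_derivative:
  fixes x :: "real \<Rightarrow> real ^ 'n"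
  assumes "has_gen_deriv_vec T \<alpha> a x v t" and "t \<ge> a" and "T t \<alpha> > 0"
  shows "(x has_vector_derivative (v /\<^sub>R T t \<alpha>)) (at t within {a..})"
proof -
  have "(*) (v $ i / T t \<alpha>) = (\<lambda>h. (h *\<^sub>R (v /\<^sub>R T t \<alpha>)) $ i)" for i
    by (simp add: fun_eq_iff divide_inverse)
  moreover have "((\<lambda>s. x s $ i) has_derivative (*) (v $ i / T t \<alpha>)) (at t within {a..})" for i
    using has_gen_deriv_imp_has_real_derivative[of T \<alpha> a "\<lambda>s. x s $ i" "v $ i" t] assms
    unfolding has_gen_deriv_vec_def has_field_derivative_def by simp
  ultimately have "((\<lambda>s. x s $ i) has_derivative (\<lambda>h. (h *\<^sub>R (v /\<^sub>R T t \<alpha>)) $ i)) (at t within {a..})" for i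
    by simp
  then show ?thesis
    unfolding has_vector_derivative_def
    by (subst has_derivative_componentwise_within) (auto simp: Basis_vec_def inner_axis)
qed

text \<open>A Gronwall estimate whose constant depends on neither \<open>t0\<close> nor
  \<open>t\<close>, which is what makes the stability uniform. The proof works with the squared norm
  because the norm itself may fail to be differentiable where \<open>x\<close> vanishes.\<close>

lemma norm_le_exp_integral:
  fixes x :: "real \<Rightarrow> 'a :: real_inner"
  assumes deriv: "\<And>t. t \<ge> a \<Longrightarrow> (x has_vector_derivative x' t) (at t within {a..})"
    and bound: "\<And>t. t \<ge> a \<Longrightarrow> norm (x' t) \<le> g t * norm (x t)"
    and g: "continuous_on {a..} g" "\<And>t. t \<ge> a \<Longrightarrow> g t \<ge> 0" "g integrable_on {a..}"
    and le: "a \<le> t0" "t0 \<le> t"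
  shows "norm (x t) \<le> exp (integral {a..} g) * norm (x t0)"
proof -
  \<comment> \<open>Starting the integral at \<open>t0\<close> instead of \<open>a\<close> changes
    \<open>u\<close> only by a constant factor and gives \<open>K t0 = 0\<close>.\<close>
  define K where "K s = integral {t0..s} g" for s
  define u where "u s = (x s \<bullet> x s) * exp (- 2 * K s)" for s
  have cg: "continuous_on {t0..t} g"
    using g(1) le by (auto intro: continuous_on_subset)
  have K: "(K has_vector_derivative g s) (at s within {t0..t})" if "s \<in> {t0..t}" for s
    unfolding K_def by (rule integral_has_vector_derivative[OF cg that])
  have xd: "(x has_vector_derivative x' s) (at s within {t0..t})" if "s \<in> {t0..t}" for s
    by (rule has_vector_derivative_within_subset[OF deriv]) (use that le in auto)
  have contK: "continuous_on {t0..t} K" and contx: "continuous_on {t0..t} x"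
    using has_vector_derivative_continuous[OF K] has_vector_derivative_continuous[OF xd]
    by (simp_all add: continuous_on_eq_continuous_within)
  have contu: "continuous_on {t0..t} u"
    unfolding u_def by (intro continuous_intros contK contx)
  have "u t \<le> u t0"
  \<comment> \<open>This rule asks for two-sided derivatives only inside the interval; at the
    endpoints, where \<open>x\<close> may have just a one-sided derivative, continuity
    suffices.\<close>
  proof (rule DERIV_nonpos_imp_decreasing_open[OF le(2) _ contu])
    fix s assume s: "t0 < s" "s < t"
    have at: "at s within {t0..t} = at s"
      using s by (rule at_within_Icc_at)
    have "(K has_real_derivative g s) (at s)"
      using K[of s] s at by (simp add: has_real_derivative_iff_has_vector_derivative)
    moreover have "((\<lambda>s. x s \<bullet> x s) has_real_derivative 2 * (x s \<bullet> x' s)) (at s)"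
      using bounded_bilinear.has_vector_derivative[OF bounded_bilinear_inner xd xd, of s] s at
      by (simp add: has_real_derivative_iff_has_vector_derivative inner_commute)
    ultimately have "(u has_real_derivative
        2 * (x s \<bullet> x' s - g s * (x s \<bullet> x s)) * exp (- 2 * K s)) (at s)"
      unfolding u_def by (auto intro!: derivative_eq_intros simp: algebra_simps)
    \<comment> \<open>This inequality makes the derivative of \<open>u\<close> nonpositive.\<close>
    moreover have "x s \<bullet> x' s \<le> g s * (x s \<bullet> x s)"
    proof -
      have "x s \<bullet> x' s \<le> norm (x s) * norm (x' s)" by (rule norm_cauchy_schwarz)
      also have "\<dots> \<le> norm (x s) * (g s * norm (x s))"
        using bound[of s] s le by (intro mult_left_mono) auto
      finally show ?thesis
        unfolding power2_norm_eq_inner[symmetric] power2_eq_square by (simp only: ac_simps)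
    qed
    ultimately show "\<exists>y. (u has_real_derivative y) (at s) \<and> y \<le> 0"
      by (auto intro!: exI mult_nonpos_nonneg)
  qed
  then have "x t \<bullet> x t \<le> exp (2 * K t) * (x t0 \<bullet> x t0)"
    by (simp add: u_def K_def exp_minus field_simps)
  then have "(norm (x t))\<^sup>2 \<le> (exp (K t) * norm (x t0))\<^sup>2"
    unfolding power2_norm_eq_inner[symmetric] power_mult_distrib exp_double .
  then have "norm (x t) \<le> exp (K t) * norm (x t0)"
    by (rule power2_le_imp_le) simp
  \<comment> \<open>As \<open>g\<close> is nonnegative, enlarging \<open>{t0..t}\<close> to the
    half-line cannot decrease the integral.\<close>
  also have "K t \<le> integral {a..} g"
    unfolding K_def using le g cg by (intro integral_subset_le integrable_continuous_real) auto
  then have "exp (K t) * norm (x t0) \<le> exp (integral {a..} g) * norm (x t0)"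
    by (intro mult_right_mono) auto
  finally show ?thesis .
qed

theorem theorem18:
  fixes T :: "real \<Rightarrow> real \<Rightarrow> real"
    and \<alpha> a :: real
    and F :: "real \<Rightarrow> real ^ 'n \<Rightarrow> real ^ 'n"
    and k :: "real \<Rightarrow> real"
  assumes "0 < \<alpha>" and "\<alpha> \<le> 1"
    and "continuous_on {a..} (\<lambda>t. T t \<alpha>)"
    and "\<And>t. t \<ge> a \<Longrightarrow> T t \<alpha> > 0"
    and "C_Lip_on ({a..} \<times> UNIV) F"
    and "\<And>t. t \<ge> a \<Longrightarrow> F t 0 = 0"
    and "continuous_on {a..} k"
    and "\<And>t x. t \<ge> a \<Longrightarrow> norm (F t x) \<le> k t * norm x"
    and "(\<lambda>t. k t / T t \<alpha>) integrable_on {a..}"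
  shows "uniformly_stable_zero T \<alpha> a F"
  unfolding uniformly_stable_zero_def
proof (intro allI impI)
  fix \<epsilon> :: real assume "\<epsilon> > 0"
  let ?g = "\<lambda>t. k t / T t \<alpha>"
  let ?E = "exp (integral {a..} ?g)"
  \<comment> \<open>The growth bound at a unit vector gives
    \<open>0 \<le> norm (F t e) \<le> k t\<close>; \<open>undefined\<close> merely picks some
    coordinate.\<close>
  have k_nonneg: "k t \<ge> 0" if "t \<ge> a" for t
    using assms(8)[OF that, of "axis undefined 1"] norm_ge_zero[of "F t (axis undefined 1)"]
    by (simp del: norm_ge_zero)
  have "norm (x t) < \<epsilon>"
    if "t0 \<ge> a" "norm x0 < \<epsilon> / ?E" and sol: "ivp_solution T \<alpha> a F t0 x0 x" and "t \<ge> t0"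
    for t0 x0 x t
  proof -
    have "norm (x t) \<le> ?E * norm (x t0)"
    proof (rule norm_le_exp_integral[where x' = "\<lambda>s. F s (x s) /\<^sub>R T s \<alpha>"])
      show "(x has_vector_derivative (F s (x s) /\<^sub>R T s \<alpha>)) (at s within {a..})" if "s \<ge> a" for s
        using sol that assms(4)
        by (auto simp: ivp_solution_def intro: has_gen_deriv_vec_imp_has_vector_derivative)
      show "norm (F s (x s) /\<^sub>R T s \<alpha>) \<le> ?g s * norm (x s)" if "s \<ge> a" for s
        using assms(4)[OF that] assms(8)[OF that, of "x s"] by (simp add: field_simps)
      show "continuous_on {a..} ?g"
        using assms(3,4,7) by (intro continuous_intros) (auto simp: less_imp_neq[symmetric])
      show "?g s \<ge> 0" if "s \<ge> a" for s
        using k_nonneg[OF that] assms(4)[OF that] by simp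
    qed (use assms(9) that in auto)
    also have "\<dots> < \<epsilon>"
      using that by (simp add: ivp_solution_def field_simps)
    finally show ?thesis .
  qed
  then show "\<exists>\<delta>>0. \<forall>t0\<ge>a. \<forall>x0 x. norm x0 < \<delta> \<longrightarrow> ivp_solution T \<alpha> a F t0 x0 x \<longrightarrow>
      (\<forall>t\<ge>t0. norm (x t) < \<epsilon>)"
    using \<open>\<epsilon> > 0\<close> by (intro exI[of _ "\<epsilon> / ?E"]) auto
qed

end
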